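(* Let $\mathcal X\neq\{\theta\}$ be a linear space over the field $\mathbb K$ of real or complex numbers. Two norms $f,g$ on $\mathcal X$ are non-equivalent if and only if $\Psi(f,g)=0$, where $\Psi(f,g):=\min\{C_f(g),C_g(f)\}$.
   Context: Let $\mathcal N(\mathcal X)$ be the set of all norms on $\mathcal X$ together with the constant zero function $O$, with operations $(f+g)(x)=f(x)+g(x)$, $(\alpha f)(x)=|\alpha|f(x)$ for $\alpha\in\mathbb K$, and order $f\le g$ iff $f(x)\le g(x)$ for all $x\in\mathcal X$. For $f,g\in\mathcal N(\mathcal X)$ the comparing spectrum of $g$ relative to $f$ is $\sigma_f(g):=\{\lambda\in\mathbb K:\lambda f\le g\}=\{\lambda\in\mathbb K: |\lambda|f(x)\le g(x)\ \text{for all } x\in\mathcal X\}$. For $f\ne O$ this set is nonempty and bounded, and the comparing function relative to $f$ is $C_f(g):=\sup_{\lambda\in\sigma_f(g)}|\lambda|\in[0,\infty)$. The map $\Psi$ is defined on $\mathcal N_*(\mathcal X)\times\mathcal N_*(\mathcal X)$ with values in $[0,\infty)$, where $\mathcal N_*(\mathcal X):=\mathcal N(\mathcal X)\smallsetminus\{O\}$. Two norms $f,g$ on $\mathcal X$ are equivalent if there exist $\lambda,\mu>0$ with $\lambda f(x)\le g(x)\le\mu f(x)$ for all $x\in\mathcal X$. *)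

theory Defs
  imports Complex_Main
begin

text \<open>
  The scalar field \<open>\<K>\<close> is \<open>\<real>\<close> or \<open>\<complex>\<close>. Since the norm of a \<^class>\<open>real_normed_field\<close> is multiplicative
  and extends the absolute value of the reals, the axiom below leaves, up to isometric
  isomorphism, exactly the real numbers and the complex numbers with their usual absolute value.
\<close>

class real_or_complex_field = real_normed_field +
  assumes real_or_complex:
    "(\<forall>z. \<exists>a. z = a *\<^sub>R 1) \<or>
     (\<exists>i. i * i = - 1 \<and> (\<forall>z. \<exists>a b. z = a *\<^sub>R 1 + b *\<^sub>R i))"

instance real :: real_or_complex_field
  by standard simp

instance complex :: real_or_complex_field
proof
  have "\<exists>a b. z = a *\<^sub>R 1 + b *\<^sub>R \<i>" for z :: complex
    by (intro exI[of _ "Re z"] exI[of _ "Im z"]) (simp add: complex_eq_iff)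
  moreover have "\<i> * \<i> = - 1"
    by simp
  ultimately show "(\<forall>z::complex. \<exists>a. z = a *\<^sub>R 1) \<or>
     (\<exists>i::complex. i * i = - 1 \<and> (\<forall>z. \<exists>a b. z = a *\<^sub>R 1 + b *\<^sub>R i))"
    by blast
qed

definition is_norm :: "('k::real_or_complex_field \<Rightarrow> 'a::ab_group_add \<Rightarrow> 'a) \<Rightarrow> ('a \<Rightarrow> real) \<Rightarrow> bool" where
  "is_norm scale f \<longleftrightarrow>
     (\<forall>x. 0 \<le> f x) \<and>
     (\<forall>x. f x = 0 \<longleftrightarrow> x = 0) \<and>
     (\<forall>\<alpha> x. f (scale \<alpha> x) = norm \<alpha> * f x) \<and>
     (\<forall>x y. f (x + y) \<le> f x + f y)"

definition equivalent_norms :: "('a \<Rightarrow> real) \<Rightarrow> ('a \<Rightarrow> real) \<Rightarrow> bool" where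
  "equivalent_norms f g \<longleftrightarrow>
     (\<exists>c>0. \<exists>d>0. \<forall>x. c * f x \<le> g x \<and> g x \<le> d * f x)"

definition scale_fun :: "'k::real_or_complex_field \<Rightarrow> ('a \<Rightarrow> real) \<Rightarrow> 'a \<Rightarrow> real" where
  "scale_fun \<alpha> f = (\<lambda>x. norm \<alpha> * f x)"

text \<open>Inequality of functions is the pointwise order.\<close>

definition comparing_spectrum :: "('a \<Rightarrow> real) \<Rightarrow> ('a \<Rightarrow> real) \<Rightarrow> 'k::real_or_complex_field set" where
  "comparing_spectrum f g = {\<alpha>. scale_fun \<alpha> f \<le> g}"

text \<open>
  The scalar field does not occur in the type of the functions to be compared, so it is passed as
  a type argument.
\<close>

definition comparing_function ::
    "'k::real_or_complex_field itself \<Rightarrow> ('a \<Rightarrow> real) \<Rightarrow> ('a \<Rightarrow> real) \<Rightarrow> real" where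
  "comparing_function _ f g = (SUP \<alpha>\<in>(comparing_spectrum f g :: 'k set). norm \<alpha>)"

definition Psi ::
    "'k::real_or_complex_field itself \<Rightarrow> ('a \<Rightarrow> real) \<Rightarrow> ('a \<Rightarrow> real) \<Rightarrow> real" where
  "Psi K f g = min (comparing_function K f g) (comparing_function K g f)"

text \<open>
  The supremum of a set of reals is meaningful only for nonempty sets that are bounded above,
  which is the case here.
\<close>

lemma comparing_spectrum_nonempty:
  assumes "\<And>x. 0 \<le> g x"
  shows "(comparing_spectrum f g :: 'k::real_or_complex_field set) \<noteq> {}"
proof -
  have "(0::'k) \<in> comparing_spectrum f g"
    using assms by (simp add: comparing_spectrum_def scale_fun_def le_fun_def)
  then show ?thesis by blast
qed

lemma comparing_spectrum_bdd_above:
  assumes "\<And>x. 0 \<le> f x" and "f \<noteq> (\<lambda>x. 0)"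
  shows "bdd_above (norm ` (comparing_spectrum f g :: 'k::real_or_complex_field set))"
proof -
  from assms obtain x where "f x > 0"
    by (metis order_le_less)
  then have "norm \<alpha> \<le> g x / f x" if "\<alpha> \<in> comparing_spectrum f g" for \<alpha> :: 'k
    using that by (simp add: comparing_spectrum_def scale_fun_def le_fun_def pos_le_divide_eq)
  then show ?thesis
    by (intro bdd_aboveI2)
qed

end

theory Submission
  imports Defs
begin

text \<open>
  The number \<open>C\<^sub>f(g)\<close> is positive exactly when some positive multiple of \<open>f\<close> lies below \<open>g\<close>
  (\<open>comparing_function_pos_iff\<close>): a supremum of nonnegative numbers is positive iff one of them is,
  and a scalar enters the spectrum only through its modulus, which can be any nonnegative real number. An upper bound \<open>g \<le> d f\<close> is the same as the lower bound
  \<open>d\<^sup>-\<^sup>1 g \<le> f\<close>, so two norms are equivalent iff each dominates a positive multiple of the other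
  (\<open>equivalent_norms_iff_mutual_lower_bounds\<close>), that is, iff \<open>C\<^sub>f(g)\<close> and \<open>C\<^sub>g(f)\<close> are both
  positive. Since neither number can be negative, this fails precisely when their minimum is zero.
\<close>

lemma comparing_function_nonneg:
  assumes "\<And>x. 0 \<le> f x" and "f \<noteq> (\<lambda>x. 0)" and "\<And>x. 0 \<le> g x"
  shows "0 \<le> comparing_function TYPE('k::real_or_complex_field) f g"
proof -
  have "(0::'k) \<in> comparing_spectrum f g"
    using assms(3) by (simp add: comparing_spectrum_def scale_fun_def le_fun_def)
  from cSUP_upper[OF this comparing_spectrum_bdd_above[OF assms(1,2)]]
  show ?thesis
    by (simp add: comparing_function_def)
qed

lemma comparing_function_pos_iff:
  assumes "\<And>x. 0 \<le> f x" and "f \<noteq> (\<lambda>x. 0)" and "\<And>x. 0 \<le> g x"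
  shows "0 < comparing_function TYPE('k::real_or_complex_field) f g
    \<longleftrightarrow> (\<exists>c>0. \<forall>x. c * f x \<le> g x)"
proof -
  have "0 < comparing_function TYPE('k) f g
      \<longleftrightarrow> (\<exists>\<alpha>\<in>(comparing_spectrum f g :: 'k set). 0 < norm \<alpha>)"
    unfolding comparing_function_def
    using comparing_spectrum_nonempty[OF assms(3)] comparing_spectrum_bdd_above[OF assms(1,2)]
    by (rule less_cSUP_iff)
  also have "\<dots> \<longleftrightarrow> (\<exists>c>0. \<forall>x. c * f x \<le> g x)"
  proof
    assume "\<exists>\<alpha>\<in>(comparing_spectrum f g :: 'k set). 0 < norm \<alpha>"
    then show "\<exists>c>0. \<forall>x. c * f x \<le> g x"
      unfolding comparing_spectrum_def scale_fun_def le_fun_def by blast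
  next
    assume "\<exists>c>0. \<forall>x. c * f x \<le> g x"
    then obtain c where "c > 0" and "\<forall>x. c * f x \<le> g x"
      by blast
    then have "of_real c \<in> (comparing_spectrum f g :: 'k set)" and "0 < norm (of_real c :: 'k)"
      by (simp_all add: comparing_spectrum_def scale_fun_def le_fun_def)
    then show "\<exists>\<alpha>\<in>(comparing_spectrum f g :: 'k set). 0 < norm \<alpha>"
      by blast
  qed
  finally show ?thesis .
qed

lemma equivalent_norms_iff_mutual_lower_bounds:
  "equivalent_norms f g \<longleftrightarrow>
    (\<exists>c>0. \<forall>x. c * f x \<le> g x) \<and> (\<exists>c>0. \<forall>x. c * g x \<le> f x)"
proof -
  have "(\<exists>d>0. \<forall>x. g x \<le> d * f x) \<longleftrightarrow> (\<exists>c>0. \<forall>x. c * g x \<le> f x)"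
  proof
    assume "\<exists>d>0. \<forall>x. g x \<le> d * f x"
    then obtain d where "d > 0" and "\<forall>x. g x \<le> d * f x"
      by blast
    then have "inverse d > 0" and "\<forall>x. inverse d * g x \<le> f x"
      by (simp_all add: field_simps)
    then show "\<exists>c>0. \<forall>x. c * g x \<le> f x"
      by blast
  next
    assume "\<exists>c>0. \<forall>x. c * g x \<le> f x"
    then obtain c where "c > 0" and "\<forall>x. c * g x \<le> f x"
      by blast
    then have "inverse c > 0" and "\<forall>x. g x \<le> inverse c * f x"
      by (simp_all add: field_simps)
    then show "\<exists>d>0. \<forall>x. g x \<le> d * f x"
      by blast
  qed
  then show ?thesis
    unfolding equivalent_norms_def by blast
qed

lemma is_norm_nonneg: "is_norm scale f \<Longrightarrow> 0 \<le> f x"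
  by (simp add: is_norm_def)

lemma is_norm_nonzero:
  fixes f :: "'a::ab_group_add \<Rightarrow> real"
  assumes "is_norm scale f" and "\<exists>x::'a. x \<noteq> 0"
  shows "f \<noteq> (\<lambda>x. 0)"
  using assms unfolding is_norm_def by metis

theorem theorem4p11:
  fixes scale :: "'k::real_or_complex_field \<Rightarrow> 'a::ab_group_add \<Rightarrow> 'a"
    and f g :: "'a \<Rightarrow> real"
  assumes "vector_space scale"
    and "\<exists>x::'a. x \<noteq> 0"
    and "is_norm scale f"
    and "is_norm scale g"
  shows "\<not> equivalent_norms f g \<longleftrightarrow> Psi TYPE('k) f g = 0"
proof -
  note f = is_norm_nonneg[OF assms(3)] is_norm_nonzero[OF assms(3,2)]
  note g = is_norm_nonneg[OF assms(4)] is_norm_nonzero[OF assms(4,2)]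
  have "equivalent_norms f g \<longleftrightarrow>
      0 < comparing_function TYPE('k) f g \<and> 0 < comparing_function TYPE('k) g f"
    by (simp add: equivalent_norms_iff_mutual_lower_bounds
        comparing_function_pos_iff[OF f g(1)] comparing_function_pos_iff[OF g f(1)])
  moreover have "0 \<le> comparing_function TYPE('k) f g"
    using f g(1) by (rule comparing_function_nonneg)
  moreover have "0 \<le> comparing_function TYPE('k) g f"
    using g f(1) by (rule comparing_function_nonneg)
  ultimately show ?thesis
    unfolding Psi_def by linarith
qed

end
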